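(* Let $r\ge 1$ be a natural number and let $(b_n)_{n\ge1}$ be a sequence of nonnegative real numbers with $(b_n)\in GM(\beta^{\ast},r)$. If the series $$\sum_{n=1}^{\infty}b_n\sin nx$$ converges uniformly in $x\in\mathbb{R}$, or if this series is the Fourier series of a continuous ($2\pi$-periodic) function, then $nb_n\to0$ as $n\to\infty$.
   Context: $\mathbb{N}=\{1,2,3,\dots\}$ and $[x]$ denotes the integer part of $x$. Sequences $a=(a_n)_{n\ge 1}$ are sequences of complex numbers indexed by the positive integers. For $r\in\mathbb{N}$, the class $GM(\beta^{\ast},r)$ is the set of all complex sequences $a=(a_n)$ for which there exist a real number $c>1$ and a constant $K(a)$ (both may depend on the sequence $a$, but not on $m$) such that for all $m\in\mathbb{N}$ $$\sum_{n=m}^{2m-1}|a_n-a_{n+r}|\le K(a)\,\beta^{\ast}_m,\qquad \beta^{\ast}_m=\sum_{k=m}^{m+r-1}|a_k|+\sum_{k=[m/c]}^{[cm]}\frac{|a_k|}{k}.$$ In the last sum only indices $k\ge 1$ are taken (i.e. if $[m/c]=0$ the sum starts at $k=1$). *)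

theory Defs
  imports "HOL-Analysis.Analysis"
begin

text \<open>
  A sequence \<open>(a\<^sub>n)\<close> indexed by \<open>n \<ge> 1\<close> is a function on \<^typ>\<open>nat\<close> whose value at \<open>0\<close> is never used.
\<close>

definition beta_star :: "nat \<Rightarrow> real \<Rightarrow> (nat \<Rightarrow> complex) \<Rightarrow> nat \<Rightarrow> real" where
  "beta_star r c a m =
     (\<Sum>k = m..m + r - 1. cmod (a k)) +
     (\<Sum>k = max 1 (nat \<lfloor>real m / c\<rfloor>)..nat \<lfloor>c * real m\<rfloor>. cmod (a k) / real k)"

definition GM_beta_star :: "nat \<Rightarrow> (nat \<Rightarrow> complex) set" where
  "GM_beta_star r =
     {a. \<exists>c>1. \<exists>K::real. \<forall>m\<ge>1.
           (\<Sum>n = m..2 * m - 1. cmod (a n - a (n + r))) \<le> K * beta_star r c a m}"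

definition fourier_cos_coeff :: "(real \<Rightarrow> complex) \<Rightarrow> nat \<Rightarrow> complex" where
  "fourier_cos_coeff f n =
     complex_of_real (1 / pi) * integral {-pi..pi} (\<lambda>x. f x * complex_of_real (cos (real n * x)))"

definition fourier_sin_coeff :: "(real \<Rightarrow> complex) \<Rightarrow> nat \<Rightarrow> complex" where
  "fourier_sin_coeff f n =
     complex_of_real (1 / pi) * integral {-pi..pi} (\<lambda>x. f x * complex_of_real (sin (real n * x)))"

text \<open>
  The sine series \<open>\<Sum>n\<ge>1. b\<^sub>n sin (n x)\<close> is the Fourier series of \<open>f\<close>: all cosine coefficients,
  including the constant one, vanish, and the sine coefficients are the \<open>b\<^sub>n\<close>.
  The coefficients are only meaningful for integrable \<open>f\<close>.
\<close>

definition sine_series_is_fourier_series_of :: "(nat \<Rightarrow> real) \<Rightarrow> (real \<Rightarrow> complex) \<Rightarrow> bool" where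
  "sine_series_is_fourier_series_of b f \<longleftrightarrow>
     (\<forall>n. fourier_cos_coeff f n = 0) \<and>
     (\<forall>n\<ge>1. fourier_sin_coeff f n = complex_of_real (b n))"

end

theory Submission imports Defs begin

text \<open>
  Both hypotheses say that the means \<open>(\<Sum>j=1..n. j b\<^sub>j) / n\<close> tend to zero: if the series converges
  uniformly, evaluate the \<open>n\<close>-th partial sum at \<open>1/n\<close>; if it is the Fourier series of a continuous
  \<open>f\<close>, integrate \<open>f - f 0\<close> against \<open>sin (n x)\<close> times the Fejer kernel of order \<open>n\<close>, which is a sine
  polynomial with nonnegative coefficients.  The \<open>GM\<close> condition with base point \<open>\<mu>\<close>, telescoped along
  a progression of step \<open>r\<close>, bounds \<open>b\<^sub>m\<close> by a window sum at \<open>\<mu>\<close> plus a sum over \<open>[\<mu>/c, c\<mu>]\<close>.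
  Averaging over \<open>m/2 < \<mu> \<le> m\<close> bounds \<open>m b\<^sub>m\<close> by a constant times one of these means.
\<close>

section \<open>Averaging the generalized monotonicity condition\<close>

text \<open>Going back from \<open>m\<close> in steps of \<open>r\<close> ends at the index of the
  window \<open>{\<mu>..\<mu> + r - 1}\<close> congruent to \<open>m\<close> modulo
  \<open>r\<close>. The differences met on the way have distinct base indices in the range of the
  variation sum, and nonnegativity bounds the end value by the window sum.\<close>

lemma progression_variation_bound:
  fixes b :: "nat \<Rightarrow> real"
  assumes r: "r \<ge> 1" and nonneg: "\<And>n. n \<ge> 1 \<Longrightarrow> b n \<ge> 0"
    and mu: "1 \<le> \<mu>" "\<mu> \<le> m" "m \<le> 2 * \<mu>"
  shows "b m \<le> (\<Sum>k = \<mu>..\<mu> + r - 1. b k) + (\<Sum>n = \<mu>..2 * \<mu> - 1. \<bar>b n - b (n + r)\<bar>)"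
proof -
  define p where "p = \<mu> + (m - \<mu>) mod r"
  define t where "t = (m - \<mu>) div r"
  have m: "m = p + t * r"
    using mu div_mult_mod_eq[of "m - \<mu>" r] by (simp add: p_def t_def)
  have tele: "b (p + t * r) \<le> b p + (\<Sum>i<t. \<bar>b (p + i * r) - b (p + i * r + r)\<bar>)" for t
  proof (induction t)
    case (Suc t)
    have "p + Suc t * r = p + t * r + r" by simp
    then show ?case using Suc by (simp only: sum.lessThan_Suc)
  qed simp
  have inj: "inj_on (\<lambda>i. p + i * r) {..<t}"
    using r by (auto simp: inj_on_def)
  have sub: "(\<lambda>i. p + i * r) ` {..<t} \<subseteq> {\<mu>..2 * \<mu> - 1}"
  proof
    fix n assume "n \<in> (\<lambda>i. p + i * r) ` {..<t}"
    then obtain i where i: "i < t" "n = p + i * r" by auto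
    \<comment> \<open>The last step starts at \<open>m - r\<close>. So
      \<open>n + r \<le> m \<le> 2 * \<mu>\<close>, and \<open>r \<ge> 1\<close> keeps
      \<open>n\<close> below \<open>2 * \<mu>\<close>.\<close>
    have "Suc i * r \<le> t * r" using i by (intro mult_le_mono1) simp
    then have "n + r \<le> m" using i m by simp
    then show "n \<in> {\<mu>..2 * \<mu> - 1}" using i mu r by (simp add: p_def)
  qed
  have "(\<Sum>i<t. \<bar>b (p + i * r) - b (p + i * r + r)\<bar>)
      = (\<Sum>n\<in>(\<lambda>i. p + i * r) ` {..<t}. \<bar>b n - b (n + r)\<bar>)"
    by (simp add: sum.reindex[OF inj])
  also have "\<dots> \<le> (\<Sum>n = \<mu>..2 * \<mu> - 1. \<bar>b n - b (n + r)\<bar>)"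
    by (intro sum_mono2 sub) auto
  finally have "b m \<le> b p + (\<Sum>n = \<mu>..2 * \<mu> - 1. \<bar>b n - b (n + r)\<bar>)"
    using tele[of t] m by simp
  moreover have "(m - \<mu>) mod r < r" using r by simp
  then have "b p \<le> (\<Sum>k = \<mu>..\<mu> + r - 1. b k)"
    by (intro member_le_sum) (use mu nonneg in \<open>auto simp: p_def\<close>)
  ultimately show ?thesis by simp
qed

text \<open>With base point \<open>m\<close> itself the bound is void, since the window contains
  \<open>b m\<close>. Summing over the base points in (m/2, m] counts each \<open>b j\<close> at
  most \<open>r\<close> times in the windows, and all indices involved are at least a constant times
  \<open>m\<close>; hence the weight \<open>j / m\<close> can be inserted.\<close>

lemma GM_beta_star_term_bound:
  fixes b :: "nat \<Rightarrow> real"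
  assumes r: "r \<ge> 1" and nonneg: "\<And>n. n \<ge> 1 \<Longrightarrow> b n \<ge> 0"
    and GM: "(\<lambda>n. complex_of_real (b n)) \<in> GM_beta_star r"
  obtains C :: real and L :: nat where "L \<ge> 1"
    "\<And>m. m \<ge> 1 \<Longrightarrow> real m * b m \<le> C * ((\<Sum>j = 1..L * m. real j * b j) / real m)"
proof -
  from GM obtain c K where c: "c > 1"
    and K: "\<And>m. m \<ge> 1 \<Longrightarrow> (\<Sum>n = m..2 * m - 1. cmod (complex_of_real (b n) - complex_of_real (b (n + r))))
              \<le> K * beta_star r c (\<lambda>n. complex_of_real (b n)) m"
    by (auto simp: GM_beta_star_def)
  define W where "W \<mu> = (\<Sum>k = \<mu>..\<mu> + r - 1. b k)" for \<mu>
  define V where "V \<mu> = (\<Sum>k = max 1 (nat \<lfloor>real \<mu> / c\<rfloor>)..nat \<lfloor>c * real \<mu>\<rfloor>. b k / real k)" for \<mu>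
  \<comment> \<open>\<open>L\<close> exceeds both \<open>c\<close> and \<open>r + 1\<close>, so
    \<open>L * m\<close> lies beyond every index \<open>k \<le> c * \<mu>\<close> and every
    \<open>\<mu> + s\<close> with \<open>s < r\<close>.\<close>
  define L where "L = nat \<lceil>c\<rceil> + r + 1"
  \<comment> \<open>The outer 2 compensates for having only about \<open>m / 2\<close> base points;
    the summands come from \<open>W_sum\<close> and \<open>V_sum\<close>.\<close>
  define C where "C = 2 * (2 * (1 + \<bar>K\<bar>) * real r + 16 * c^2 * \<bar>K\<bar>)"
  have Lc: "c \<le> real L" unfolding L_def by linarith
  have W0: "W \<mu> \<ge> 0" if "\<mu> \<ge> 1" for \<mu>
    unfolding W_def by (intro sum_nonneg nonneg) (use that in auto)
  have V0: "V \<mu> \<ge> 0" for \<mu>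
    unfolding V_def by (intro sum_nonneg divide_nonneg_nonneg nonneg) auto
  \<comment> \<open>The sign of \<open>K\<close> is unknown; a nonnegative factor is needed to
    insert upper bounds for \<open>W\<close> and \<open>V\<close> later.\<close>
  have var: "(\<Sum>n = \<mu>..2 * \<mu> - 1. \<bar>b n - b (n + r)\<bar>) \<le> \<bar>K\<bar> * (W \<mu> + V \<mu>)" if "\<mu> \<ge> 1" for \<mu>
  proof -
    have "beta_star r c (\<lambda>n. complex_of_real (b n)) \<mu> = W \<mu> + V \<mu>"
      unfolding beta_star_def W_def V_def using that nonneg
      by (auto intro!: arg_cong2[where f="(+)"] sum.cong)
    moreover have "K * (W \<mu> + V \<mu>) \<le> \<bar>K\<bar> * (W \<mu> + V \<mu>)"
      using W0[OF that] V0[of \<mu>] by (intro mult_right_mono) auto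
    ultimately show ?thesis using K[OF that] by (simp flip: of_real_diff)
  qed
  have "real m * b m \<le> C * ((\<Sum>j = 1..L * m. real j * b j) / real m)" if m: "m \<ge> 1" for m
  proof -
    define S where "S = (\<Sum>j = 1..L * m. real j * b j)"
    define I where "I = {m div 2 + 1..m}"
    have S0: "S \<ge> 0" unfolding S_def by (intro sum_nonneg mult_nonneg_nonneg nonneg) auto
    have I: "1 \<le> \<mu>" "\<mu> \<le> m" "m \<le> 2 * \<mu>" if "\<mu> \<in> I" for \<mu>
      using that by (auto simp: I_def)
    have cardI: "real m / 2 \<le> real (card I)" "card I \<le> m"
      by (auto simp: I_def field_simps)
    have V_le: "V \<mu> \<le> 16 * c^2 / (real m)^2 * S" if mu: "\<mu> \<in> I" for \<mu>
    proof -
      have "V \<mu> \<le> (\<Sum>k = max 1 (nat \<lfloor>real \<mu> / c\<rfloor>)..nat \<lfloor>c * real \<mu>\<rfloor>. 16 * c^2 / (real m)^2 * (real k * b k))"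
        unfolding V_def
      proof (intro sum_mono)
        fix k assume k: "k \<in> {max 1 (nat \<lfloor>real \<mu> / c\<rfloor>)..nat \<lfloor>c * real \<mu>\<rfloor>}"
        have k1: "k \<ge> 1" using k by simp
        \<comment> \<open>Rounding down loses less than 1, which \<open>k \<ge> 1\<close> absorbs by
          doubling: k \<ge> \<mu>/(2c) \<ge> m/(4c). Squaring this turns the weight 1/k into a
          multiple of k/m^2.\<close>
        have "nat \<lfloor>real \<mu> / c\<rfloor> \<le> k" using k by simp
        then have "\<lfloor>real \<mu> / c\<rfloor> \<le> int k" by linarith
        then have "real \<mu> / c < real k + 1" by linarith
        then have "real \<mu> / c \<le> 2 * real k" using k1 by linarith
        then have "real \<mu> \<le> 2 * c * real k" using c by (simp add: field_simps)
        then have "real m \<le> 4 * c * real k" using I(3)[OF mu] by linarith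
        then have "(real m)^2 \<le> (4 * c * real k)^2" by (intro power_mono) auto
        then have "1 / real k \<le> 16 * c^2 / (real m)^2 * real k"
          using k1 m by (simp add: field_simps power2_eq_square)
        then have "1 / real k * b k \<le> 16 * c^2 / (real m)^2 * real k * b k"
          using nonneg[OF k1] by (intro mult_right_mono)
        then show "b k / real k \<le> 16 * c^2 / (real m)^2 * (real k * b k)"
          by (simp add: mult.assoc)
      qed
      also have "\<dots> = 16 * c^2 / (real m)^2 * (\<Sum>k = max 1 (nat \<lfloor>real \<mu> / c\<rfloor>)..nat \<lfloor>c * real \<mu>\<rfloor>. real k * b k)"
        by (simp add: sum_distrib_left)
      also have "\<dots> \<le> 16 * c^2 / (real m)^2 * S"
      proof (intro mult_left_mono)
        have "c * real \<mu> \<le> real L * real m"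
          using Lc I[OF mu] c by (intro mult_mono) auto
        then have "nat \<lfloor>c * real \<mu>\<rfloor> \<le> L * m"
          by (metis floor_mono floor_of_nat nat_int nat_mono of_nat_mult)
        then show "(\<Sum>k = max 1 (nat \<lfloor>real \<mu> / c\<rfloor>)..nat \<lfloor>c * real \<mu>\<rfloor>. real k * b k) \<le> S"
          unfolding S_def using nonneg by (intro sum_mono2) auto
      qed simp
      finally show ?thesis .
    qed
    \<comment> \<open>Writing windows as \<open>r\<close> shifts allows the sums to be swapped: for
      a fixed shift the indices \<open>\<mu> + s\<close> are distinct, so they contribute each term
      of \<open>S\<close> at most once.\<close>
    have W_eq: "W \<mu> = (\<Sum>s<r. b (\<mu> + s))" for \<mu>
      unfolding W_def
      by (rule sum.reindex_bij_witness[of _ "\<lambda>s. \<mu> + s" "\<lambda>k. k - \<mu>"]) (use r in auto)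
    have shift: "(\<Sum>\<mu>\<in>I. b (\<mu> + s)) \<le> 2 / real m * S" if s: "s < r" for s
    proof -
      have "(\<Sum>\<mu>\<in>I. b (\<mu> + s)) \<le> (\<Sum>\<mu>\<in>I. 2 / real m * (real (\<mu> + s) * b (\<mu> + s)))"
      proof (intro sum_mono)
        fix \<mu> assume "\<mu> \<in> I"
        note I' = I[OF this]
        have "1 \<le> 2 / real m * real (\<mu> + s)" using I' m by (simp add: field_simps)
        then have "1 * b (\<mu> + s) \<le> 2 / real m * real (\<mu> + s) * b (\<mu> + s)"
          using I' by (intro mult_right_mono nonneg) auto
        then show "b (\<mu> + s) \<le> 2 / real m * (real (\<mu> + s) * b (\<mu> + s))"
            by (simp only: mult_1 mult.assoc)
      qed
      also have "\<dots> = 2 / real m * (\<Sum>\<mu>\<in>I. real (\<mu> + s) * b (\<mu> + s))"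
        by (simp add: sum_distrib_left)
      also have "(\<Sum>\<mu>\<in>I. real (\<mu> + s) * b (\<mu> + s)) = (\<Sum>j\<in>(\<lambda>\<mu>. \<mu> + s) ` I. real j * b j)"
        by (simp add: sum.reindex)
      also have "2 / real m * \<dots> \<le> 2 / real m * S"
      proof (intro mult_left_mono)
        have "m + r \<le> (r + 1) * m" using m by (cases m) auto
        also have "\<dots> \<le> L * m" unfolding L_def by (intro mult_le_mono1) simp
        finally have "(\<lambda>\<mu>. \<mu> + s) ` I \<subseteq> {1..L * m}" using I s by fastforce
        then show "(\<Sum>j\<in>(\<lambda>\<mu>. \<mu> + s) ` I. real j * b j) \<le> S"
          unfolding S_def using nonneg by (intro sum_mono2) auto
      qed simp
      finally show ?thesis .
    qed
    have "(\<Sum>\<mu>\<in>I. W \<mu>) = (\<Sum>s<r. \<Sum>\<mu>\<in>I. b (\<mu> + s))"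
      unfolding W_eq by (rule sum.swap)
    also have "\<dots> \<le> (\<Sum>s<r. 2 / real m * S)" by (intro sum_mono shift) simp
    finally have W_sum: "(\<Sum>\<mu>\<in>I. W \<mu>) \<le> 2 * real r / real m * S" by (simp add: ac_simps)
    have V_sum: "(\<Sum>\<mu>\<in>I. V \<mu>) \<le> 16 * c^2 / real m * S"
    proof -
      have "(\<Sum>\<mu>\<in>I. V \<mu>) \<le> real (card I) * (16 * c^2 / (real m)^2 * S)"
        by (intro sum_bounded_above V_le)
      also have "\<dots> \<le> real m * (16 * c^2 / (real m)^2 * S)"
        using S0 cardI(2) by (intro mult_right_mono) auto
      finally show ?thesis using m by (simp add: power2_eq_square)
    qed
    have "real m / 2 * b m \<le> real (card I) * b m"
      using nonneg[OF m] cardI(1) by (intro mult_right_mono) auto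
    also have "\<dots> = (\<Sum>\<mu>\<in>I. b m)" by simp
    also have "\<dots> \<le> (\<Sum>\<mu>\<in>I. (1 + \<bar>K\<bar>) * W \<mu> + \<bar>K\<bar> * V \<mu>)"
    proof (intro sum_mono)
      fix \<mu> assume "\<mu> \<in> I"
      note I' = I[OF this]
      have "b m \<le> W \<mu> + (\<Sum>n = \<mu>..2 * \<mu> - 1. \<bar>b n - b (n + r)\<bar>)"
        unfolding W_def by (rule progression_variation_bound[OF r nonneg I'])
      also have "\<dots> \<le> W \<mu> + \<bar>K\<bar> * (W \<mu> + V \<mu>)" using var[OF I'(1)] by simp
      finally show "b m \<le> (1 + \<bar>K\<bar>) * W \<mu> + \<bar>K\<bar> * V \<mu>" by (simp add: algebra_simps)
    qed
    also have "\<dots> = (1 + \<bar>K\<bar>) * (\<Sum>\<mu>\<in>I. W \<mu>) + \<bar>K\<bar> * (\<Sum>\<mu>\<in>I. V \<mu>)"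
      by (simp add: sum.distrib sum_distrib_left)
    also have "\<dots> \<le> (1 + \<bar>K\<bar>) * (2 * real r / real m * S) + \<bar>K\<bar> * (16 * c^2 / real m * S)"
      by (intro add_mono mult_left_mono W_sum V_sum) auto
    also have "\<dots> = C / 2 * (S / real m)"
      unfolding C_def using m by (simp add: field_simps)
    finally show ?thesis unfolding S_def by simp
  qed
  then show ?thesis using that[of L C] by (simp add: L_def)
qed

lemma GM_beta_star_tendsto_zero:
  fixes b :: "nat \<Rightarrow> real"
  assumes "r \<ge> 1" and nonneg: "\<And>n. n \<ge> 1 \<Longrightarrow> b n \<ge> 0"
    and "(\<lambda>n. complex_of_real (b n)) \<in> GM_beta_star r"
    and means: "(\<lambda>n. (\<Sum>j = 1..n. real j * b j) / real n) \<longlonglongrightarrow> 0"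
  shows "(\<lambda>n. real n * b n) \<longlonglongrightarrow> 0"
proof -
  obtain C :: real and L :: nat where L: "L \<ge> 1"
    and bound: "\<And>m. m \<ge> 1 \<Longrightarrow> real m * b m \<le> C * ((\<Sum>j = 1..L * m. real j * b j) / real m)"
    using GM_beta_star_term_bound[OF assms(1-3)] by metis
  \<comment> \<open>The means are taken along the subsequence \<open>L * m\<close>; dividing by
    \<open>m\<close> instead of \<open>L * m\<close> costs the factor \<open>L\<close>.\<close>
  have "filterlim (\<lambda>m. L * m) sequentially sequentially"
    using L by (intro filterlim_subseq) (auto simp: strict_mono_def)
  from filterlim_compose[OF means this]
  have "(\<lambda>m. C * real L * ((\<Sum>j = 1..L * m. real j * b j) / real (L * m))) \<longlonglongrightarrow> C * real L * 0"
    by (intro tendsto_mult tendsto_const)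
  then have "(\<lambda>m. C * ((\<Sum>j = 1..L * m. real j * b j) / real m)) \<longlonglongrightarrow> 0"
    using L by simp
  then show ?thesis
  proof (rule tendsto_sandwich[OF _ _ tendsto_const, rotated 2])
    show "\<forall>\<^sub>F n in sequentially. 0 \<le> real n * b n"
      using eventually_ge_at_top[of 1] by eventually_elim (simp add: nonneg)
    show "\<forall>\<^sub>F n in sequentially. real n * b n \<le> C * ((\<Sum>j = 1..L * n. real j * b j) / real n)"
      using eventually_ge_at_top[of 1] by eventually_elim (rule bound)
  qed
qed

section \<open>Uniformly convergent sine series\<close>

text \<open>By the mean value theorem sin t = t cos z with 0 < z < 1 < pi/3, where the cosine is at
  least 1/2.\<close>

lemma half_le_sin:
  fixes t :: real
  assumes "0 \<le> t" "t \<le> 1"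
  shows "t / 2 \<le> sin t"
proof (cases "t = 0")
  case False
  then obtain z where z: "0 < z" "z < t" "sin t - sin 0 = (t - 0) * cos z"
    using MVT2[of 0 t sin cos] assms by (auto intro: DERIV_sin)
  have "cos (pi / 3) \<le> cos z"
    using z assms pi_gt3 by (intro cos_monotone_0_pi_le) auto
  then have "t * (1 / 2) \<le> t * cos z"
    using assms by (intro mult_left_mono) (auto simp: cos_60)
  then show ?thesis using z by simp
qed simp

text \<open>For \<open>j \<le> n\<close> the sine at \<open>j / n\<close> is at least
  \<open>j / (2 n)\<close>, so the mean is at most twice the partial sum at \<open>1 / n\<close>.
  Uniform convergence lets the evaluation point move with \<open>n\<close>, and the limit function
  is continuous and vanishes at 0.\<close>

lemma means_tendsto_zero_if_uniformly_convergent: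
  fixes b :: "nat \<Rightarrow> real"
  assumes nonneg: "\<And>n. n \<ge> 1 \<Longrightarrow> b n \<ge> 0"
    and unif: "uniformly_convergent_on UNIV (\<lambda>N x::real. \<Sum>n = 1..N. b n * sin (real n * x))"
  shows "(\<lambda>n. (\<Sum>j = 1..n. real j * b j) / real n) \<longlonglongrightarrow> 0"
proof -
  define s where "s N x = (\<Sum>n = 1..N. b n * sin (real n * x))" for N and x :: real
  obtain l where l: "uniform_limit UNIV s l sequentially"
    using unif unfolding uniformly_convergent_on_def s_def by blast
  have "continuous_on UNIV l"
    by (rule uniform_limit_theorem[OF _ l]) (auto simp: s_def intro!: always_eventually continuous_intros)
  then have "isCont l 0" by (simp add: continuous_on_eq_continuous_at)
  then have "(\<lambda>N. l (inverse (real N))) \<longlonglongrightarrow> l 0"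
    by (rule isCont_tendsto_compose) (rule lim_inverse_n)
  moreover have "l 0 = 0"
    using tendsto_uniform_limitI[OF l, of 0] by (simp add: s_def LIMSEQ_const_iff)
  moreover have "(\<lambda>N. s N (inverse (real N)) - l (inverse (real N))) \<longlonglongrightarrow> 0"
  proof (rule tendstoI)
    fix e :: real assume "e > 0"
    then have "\<forall>\<^sub>F N in sequentially. \<forall>x\<in>UNIV. dist (s N x) (l x) < e"
      using l by (auto simp: uniform_limit_iff)
    then show "\<forall>\<^sub>F N in sequentially. dist (s N (inverse (real N)) - l (inverse (real N))) 0 < e"
      by eventually_elim (simp add: dist_real_def)
  qed
  ultimately have "(\<lambda>N. 2 * (s N (inverse (real N)) - l (inverse (real N)) + l (inverse (real N)))) \<longlonglongrightarrow> 2 * (0 + 0)"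
    by (intro tendsto_intros) auto
  then have "(\<lambda>N. 2 * s N (inverse (real N))) \<longlonglongrightarrow> 0" by simp
  then show ?thesis
  proof (rule tendsto_sandwich[OF _ _ tendsto_const, rotated 2])
    show "\<forall>\<^sub>F n in sequentially. 0 \<le> (\<Sum>j = 1..n. real j * b j) / real n"
      by (intro always_eventually allI divide_nonneg_nonneg sum_nonneg mult_nonneg_nonneg nonneg) auto
    show "\<forall>\<^sub>F n in sequentially. (\<Sum>j = 1..n. real j * b j) / real n \<le> 2 * s n (inverse (real n))"
    proof (intro always_eventually allI)
      fix n
      have "(\<Sum>j = 1..n. real j * b j) / real n = (\<Sum>j = 1..n. 2 * (b j * (real j * inverse (real n) / 2)))"
        unfolding sum_divide_distrib by (intro sum.cong refl) (simp add: field_simps)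
      also have "\<dots> \<le> (\<Sum>j = 1..n. 2 * (b j * sin (real j * inverse (real n))))"
        by (intro sum_mono mult_left_mono half_le_sin nonneg) (auto simp: field_simps)
      finally show "(\<Sum>j = 1..n. real j * b j) / real n \<le> 2 * s n (inverse (real n))"
        by (simp add: s_def sum_distrib_left)
    qed
  qed
qed

section \<open>Sine series of continuous functions\<close>

definition dirichlet_kernel :: "nat \<Rightarrow> real \<Rightarrow> real" where
  "dirichlet_kernel i x = 1 + 2 * (\<Sum>k = 1..i. cos (real k * x))"

text \<open>The customary Fejer kernel is this function divided by \<open>n + 1\<close>.\<close>

definition fejer_kernel :: "nat \<Rightarrow> real \<Rightarrow> real" where
  "fejer_kernel n x = (\<Sum>i\<le>n. dirichlet_kernel i x)"

text \<open>A closed form free of quotients, hence valid at 0 too; its right-hand side telescopes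
  when summed over \<open>i\<close>.\<close>

lemma dirichlet_kernel_mult_one_minus_cos:
  "dirichlet_kernel i x * (1 - cos x) = cos (real i * x) - cos (real (Suc i) * x)"
proof (induction i)
  case (Suc i)
  have "2 * (cos (real (Suc i) * x) * cos x) = cos (real (Suc (Suc i)) * x) + cos (real i * x)"
    by (simp add: cos_times_cos algebra_simps)
  moreover have "dirichlet_kernel (Suc i) x = dirichlet_kernel i x + 2 * cos (real (Suc i) * x)"
    by (simp add: dirichlet_kernel_def)
  ultimately show ?case using Suc by (simp add: algebra_simps)
qed (simp add: dirichlet_kernel_def)

text \<open>This identity serves twice: for the nonnegativity of the kernel, and for bounding the
  kernel times \<open>1 - cos x\<close> by 2 uniformly in \<open>n\<close>.\<close>

lemma fejer_kernel_mult_one_minus_cos: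
  "fejer_kernel n x * (1 - cos x) = 1 - cos (real (Suc n) * x)"
proof -
  have "fejer_kernel n x * (1 - cos x) = (\<Sum>i\<le>n. cos (real i * x) - cos (real (Suc i) * x))"
    by (simp only: fejer_kernel_def sum_distrib_right dirichlet_kernel_mult_one_minus_cos)
  also have "\<dots> = 1 - cos (real (Suc n) * x)"
    by (subst sum_telescope) simp
  finally show ?thesis .
qed

lemma cos_eq_1_imp_zero:
  fixes x :: real
  assumes "\<bar>x\<bar> \<le> pi" "cos x = 1"
  shows "x = 0"
proof -
  obtain n :: int where n: "x = of_int n * 2 * pi" using assms(2) by (auto simp: cos_one_2pi_int)
  have "\<bar>of_int n :: real\<bar> * (2 * pi) \<le> 1 / 2 * (2 * pi)" using assms(1) n by (simp add: abs_mult)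
  then have "\<bar>of_int n :: real\<bar> \<le> 1 / 2" by (subst (asm) mult_le_cancel_right) auto
  then have "n = 0" by linarith
  then show ?thesis using n by simp
qed

lemma fejer_kernel_nonneg:
  assumes "\<bar>x\<bar> \<le> pi"
  shows "fejer_kernel n x \<ge> 0"
proof (cases "x = 0")
  case True
  then show ?thesis by (simp add: fejer_kernel_def dirichlet_kernel_def sum_nonneg)
next
  case False
  then have "cos x \<noteq> 1" using cos_eq_1_imp_zero[OF assms] by blast
  then have "1 - cos x > 0" using cos_le_one[of x] by linarith
  moreover have "fejer_kernel n x * (1 - cos x) \<ge> 0"
    using fejer_kernel_mult_one_minus_cos[of n x] by simp
  ultimately show ?thesis by (simp add: zero_le_mult_iff)
qed

text \<open>Product-to-sum turns the cosine of frequency \<open>k\<close> into the sines of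
  frequencies \<open>n - k\<close> and \<open>n + k\<close>. With \<open>i \<le> n\<close> the
  subtraction on naturals is exact.\<close>

lemma sin_mult_dirichlet_kernel:
  "i \<le> n \<Longrightarrow> sin (real n * x) * dirichlet_kernel i x = (\<Sum>j = n - i..n + i. sin (real j * x))"
proof (induction i)
  case (Suc i)
  have "{n - Suc i..n + Suc i} = insert (n - Suc i) (insert (n + Suc i) {n - i..n + i})"
    using Suc.prems by auto
  moreover have "n - Suc i \<notin> insert (n + Suc i) {n - i..n + i}" "n + Suc i \<notin> {n - i..n + i}"
    using Suc.prems by auto
  ultimately have "(\<Sum>j = n - Suc i..n + Suc i. sin (real j * x))
      = sin (real (n - Suc i) * x) + (sin (real (n + Suc i) * x) + (\<Sum>j = n - i..n + i. sin (real j * x)))"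
    by (simp only: sum.insert finite_insert finite_atLeastAtMost not_False_eq_True)
  moreover have "2 * (sin (real n * x) * cos (real (Suc i) * x))
      = sin (real (n + Suc i) * x) + sin (real (n - Suc i) * x)"
    using Suc.prems by (simp add: sin_times_cos algebra_simps of_nat_diff)
  moreover have "dirichlet_kernel (Suc i) x = dirichlet_kernel i x + 2 * cos (real (Suc i) * x)"
    by (simp add: dirichlet_kernel_def)
  ultimately show ?case using Suc by (simp add: algebra_simps)
qed (simp add: dirichlet_kernel_def)

section \<open>Integrals over one period\<close>

lemma has_integral_cos_period:
  assumes "k \<ge> 1"
  shows "((\<lambda>x. cos (real k * x)) has_integral 0) {-pi..pi}"
proof -
  have "((\<lambda>x. cos (real k * x)) has_integral (sin (real k * pi) / real k - sin (real k * - pi) / real k)) {-pi..pi}"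
    using assms
    by (intro fundamental_theorem_of_calculus)
      (auto simp flip: has_real_derivative_iff_has_vector_derivative intro!: derivative_eq_intros)
  then show ?thesis by (simp add: mult.commute[of _ pi])
qed

lemma has_integral_sin_period:
  "((\<lambda>x. sin (real k * x)) has_integral 0) {-pi..pi}"
proof (cases "k = 0")
  case False
  then have "((\<lambda>x. sin (real k * x)) has_integral (- cos (real k * pi) / real k - - cos (real k * - pi) / real k)) {-pi..pi}"
    by (intro fundamental_theorem_of_calculus)
      (auto simp flip: has_real_derivative_iff_has_vector_derivative intro!: derivative_eq_intros)
  then show ?thesis by simp
qed simp

text \<open>Only the constant 1 of each of the \<open>n + 1\<close> Dirichlet kernels survives
  integration.\<close>

lemma has_integral_fejer_kernel:
  "(fejer_kernel n has_integral 2 * pi * real (Suc n)) {-pi..pi}"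
proof -
  have "(dirichlet_kernel i has_integral 2 * pi) {-pi..pi}" for i
  proof -
    have "((\<lambda>x. 1 + 2 * (\<Sum>k = 1..i. cos (real k * x))) has_integral (2 * pi + 2 * (\<Sum>k = 1..i. 0))) {-pi..pi}"
      using has_integral_const_real[of "1::real" "-pi" pi]
      by (intro has_integral_add has_integral_mult_right has_integral_sum has_integral_cos_period) auto
    then show ?thesis by (simp add: dirichlet_kernel_def[abs_def])
  qed
  then have "((\<lambda>x. \<Sum>i\<le>n. dirichlet_kernel i x) has_integral (\<Sum>i\<le>n. 2 * pi)) {-pi..pi}"
    by (intro has_integral_sum) auto
  then show ?thesis by (simp add: fejer_kernel_def[abs_def] mult.commute)
qed

lemma continuous_on_fejer_kernel: "continuous_on S (fejer_kernel n)"
  unfolding fejer_kernel_def[abs_def] dirichlet_kernel_def[abs_def] by (intro continuous_intros)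

section \<open>Testing a continuous function against the Fejer kernel\<close>

text \<open>
  Multiplied by \<open>fejer_kernel n x\<close>, the right-hand side becomes \<open>e\<close> times the kernel plus a function
  bounded independently of \<open>n\<close>.
\<close>

lemma continuous_norm_diff_le_one_minus_cos:
  fixes f :: "real \<Rightarrow> complex"
  assumes f: "continuous_on UNIV f" and e: "e > 0"
  obtains C where "C \<ge> 0" "\<And>x. \<bar>x\<bar> \<le> pi \<Longrightarrow> norm (f x - f 0) \<le> e + C * (1 - cos x)"
proof -
  have "isCont f 0" using f by (simp add: continuous_on_eq_continuous_at)
  then obtain d where d: "d > 0" "\<And>x. \<bar>x\<bar> < d \<Longrightarrow> norm (f x - f 0) < e"
    using e by (metis LIM_eq diff_zero isCont_def norm_zero real_norm_def right_minus_eq)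
  \<comment> \<open>Capping at pi keeps \<open>d'\<close> where the cosine decreases and makes
    \<open>cos d' < 1\<close>.\<close>
  define d' where "d' = min d pi"
  have d': "d' > 0" "d' \<le> pi" "d' \<le> d" using d by (auto simp: d'_def)
  have "compact ((\<lambda>x. f x - f 0) ` {-pi..pi})"
    using f by (intro compact_continuous_image continuous_intros) (auto intro: continuous_on_subset)
  then obtain M where M: "\<And>x. \<bar>x\<bar> \<le> pi \<Longrightarrow> norm (f x - f 0) \<le> M"
    by (fastforce simp: bounded_iff abs_le_iff dest!: compact_imp_bounded)
  have M0: "M \<ge> 0" using M[of 0] by simp
  have c: "1 - cos d' > 0"
    using cos_eq_1_imp_zero[of d'] d' cos_le_one[of d'] by (smt (verit))
  \<comment> \<open>Closer to 0 than \<open>d'\<close> the summand \<open>e\<close> suffices.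
    Elsewhere \<open>1 - cos x \<ge> 1 - cos d'\<close>, so the second summand is at least
    \<open>M\<close>.\<close>
  show ?thesis
  proof (rule that[of "M / (1 - cos d')"])
    show "M / (1 - cos d') \<ge> 0" using M0 c by simp
    fix x :: real assume x: "\<bar>x\<bar> \<le> pi"
    show "norm (f x - f 0) \<le> e + M / (1 - cos d') * (1 - cos x)"
    proof (cases "\<bar>x\<bar> < d'")
      case True
      then have "norm (f x - f 0) < e" using d d' by simp
      moreover have "0 \<le> M / (1 - cos d') * (1 - cos x)" using M0 c by simp
      ultimately show ?thesis by linarith
    next
      case False
      then have "cos \<bar>x\<bar> \<le> cos d'" using d' x by (intro cos_monotone_0_pi_le) auto
      then have "M / (1 - cos d') * (1 - cos d') \<le> M / (1 - cos d') * (1 - cos x)"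
        using M0 c by (intro mult_left_mono) auto
      then show ?thesis using M[OF x] c e by simp
    qed
  qed
qed

text \<open>The test function expands into blocks of sines centred at frequency \<open>n\<close>,
  each tested by a Fourier coefficient. Subtracting \<open>f 0\<close> is free because sines have
  integral zero over a period.\<close>

lemma has_integral_fejer_test:
  fixes b :: "nat \<Rightarrow> real" and f :: "real \<Rightarrow> complex"
  assumes f: "continuous_on UNIV f" and fs: "sine_series_is_fourier_series_of b f"
  shows "((\<lambda>x. (f x - f 0) * complex_of_real (sin (real n * x) * fejer_kernel n x)) has_integral
           complex_of_real (pi * (\<Sum>i\<le>n. \<Sum>j\<in>{n - i..n + i} - {0}. b j))) {-pi..pi}"
proof -
  have coeff: "((\<lambda>x. (f x - f 0) * complex_of_real (sin (real j * x))) has_integral complex_of_real (pi * b j)) {-pi..pi}"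
    if "j \<ge> 1" for j
  proof -
    have "(\<lambda>x. f x * complex_of_real (sin (real j * x))) integrable_on {-pi..pi}"
      using f by (intro integrable_continuous_real continuous_intros) (auto intro: continuous_on_subset)
    moreover have "integral {-pi..pi} (\<lambda>x. f x * complex_of_real (sin (real j * x))) = complex_of_real (pi * b j)"
      using fs that
      by (simp add: sine_series_is_fourier_series_of_def fourier_sin_coeff_def field_simps)
    ultimately have 1: "((\<lambda>x. f x * complex_of_real (sin (real j * x))) has_integral complex_of_real (pi * b j)) {-pi..pi}"
      by (simp add: has_integral_iff)
    have "((\<lambda>x. f 0 * complex_of_real (sin (real j * x))) has_integral f 0 * complex_of_real 0) {-pi..pi}"
      by (intro has_integral_mult_right has_integral_of_real has_integral_sin_period)
    from has_integral_diff[OF 1 this] show ?thesis by (simp add: algebra_simps)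
  qed
  have "((\<lambda>x. \<Sum>i\<le>n. \<Sum>j\<in>{n - i..n + i} - {0}. (f x - f 0) * complex_of_real (sin (real j * x))) has_integral
      (\<Sum>i\<le>n. \<Sum>j\<in>{n - i..n + i} - {0}. complex_of_real (pi * b j))) {-pi..pi}"
    by (intro has_integral_sum coeff) auto
  moreover have "(\<Sum>i\<le>n. \<Sum>j\<in>{n - i..n + i} - {0}. (f x - f 0) * complex_of_real (sin (real j * x)))
      = (f x - f 0) * complex_of_real (sin (real n * x) * fejer_kernel n x)" for x
  proof -
    \<comment> \<open>Among the blocks with \<open>i \<le> n\<close>, frequency 0 occurs only for
      \<open>i = n\<close> and contributes sin 0 = 0; omitting it keeps the meaningless value
      \<open>b 0\<close> out.\<close>
    have "(\<Sum>j\<in>{n - i..n + i} - {0}. sin (real j * x)) = (\<Sum>j = n - i..n + i. sin (real j * x))" for i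
      by (intro sum.mono_neutral_left) auto
    then have "sin (real n * x) * fejer_kernel n x = (\<Sum>i\<le>n. \<Sum>j\<in>{n - i..n + i} - {0}. sin (real j * x))"
      by (simp add: fejer_kernel_def sum_distrib_left sin_mult_dirichlet_kernel)
    then show ?thesis by (simp only: of_real_sum sum_distrib_left)
  qed
  ultimately show ?thesis by (simp add: sum_distrib_left)
qed

lemma sum_le_symmetric_sums:
  fixes b :: "nat \<Rightarrow> real"
  assumes nonneg: "\<And>n. n \<ge> 1 \<Longrightarrow> b n \<ge> 0"
  shows "(\<Sum>j = 1..n. real j * b j) \<le> (\<Sum>i\<le>n. \<Sum>j\<in>{n - i..n + i} - {0}. b j)"
proof -
  have "(\<Sum>j = 1..n. real j * b j) \<le> (\<Sum>j = 1..n. \<Sum>i | i \<in> {..n} \<and> n - j \<le> i. b j)"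
  proof (intro sum_mono)
    fix j assume j: "j \<in> {1..n}"
    have "{i. i \<in> {..n} \<and> n - j \<le> i} = {n - j..n}" by auto
    then show "real j * b j \<le> (\<Sum>i | i \<in> {..n} \<and> n - j \<le> i. b j)"
      using nonneg[of j] j by (simp add: mult_right_mono)
  qed
  also have "\<dots> = (\<Sum>i\<le>n. \<Sum>j | j \<in> {1..n} \<and> n - j \<le> i. b j)"
    by (rule sum.swap_restrict) auto
  also have "\<dots> \<le> (\<Sum>i\<le>n. \<Sum>j\<in>{n - i..n + i} - {0}. b j)"
    using nonneg by (intro sum_mono sum_mono2) auto
  finally show ?thesis .
qed

lemma means_tendsto_zero_if_continuous:
  fixes b :: "nat \<Rightarrow> real" and f :: "real \<Rightarrow> complex"
  assumes nonneg: "\<And>n. n \<ge> 1 \<Longrightarrow> b n \<ge> 0"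
    and f: "continuous_on UNIV f" and fs: "sine_series_is_fourier_series_of b f"
  shows "(\<lambda>n. (\<Sum>j = 1..n. real j * b j) / real n) \<longlonglongrightarrow> 0"
proof -
  define A where "A n = (\<Sum>j = 1..n. real j * b j)" for n
  have A0: "A n \<ge> 0" for n
    unfolding A_def by (intro sum_nonneg mult_nonneg_nonneg nonneg) auto
  \<comment> \<open>\<open>C\<close> depends on \<open>e\<close> but not on \<open>n\<close>. The
    first summand comes from \<open>e\<close> times the kernel mass, the second from the uniformly
    bounded remainder; the factor pi cancels.\<close>
  have bound: "\<exists>C. \<forall>n. A n \<le> 2 * e * real (Suc n) + 4 * C" if e: "e > 0" for e
  proof -
    obtain C where C: "C \<ge> 0" "\<And>x. \<bar>x\<bar> \<le> pi \<Longrightarrow> norm (f x - f 0) \<le> e + C * (1 - cos x)"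
      using continuous_norm_diff_le_one_minus_cos[OF f e] by blast
    have "A n \<le> 2 * e * real (Suc n) + 4 * C" for n
    proof -
      define T where "T x = (f x - f 0) * complex_of_real (sin (real n * x) * fejer_kernel n x)" for x
      define B where "B = (\<Sum>i\<le>n. \<Sum>j\<in>{n - i..n + i} - {0}. b j)"
      have T: "(T has_integral complex_of_real (pi * B)) {-pi..pi}"
        unfolding T_def B_def by (rule has_integral_fejer_test[OF f fs])
      have g: "((\<lambda>x. e * fejer_kernel n x + 2 * C) has_integral
          e * (2 * pi * real (Suc n)) + 2 * pi * (2 * C)) {-pi..pi}"
        using has_integral_const_real[of "2 * C" "-pi" pi]
        by (intro has_integral_add has_integral_mult_right has_integral_fejer_kernel) auto
      have "norm (T x) \<le> e * fejer_kernel n x + 2 * C" if "x \<in> {-pi..pi}" for x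
      proof -
        have x: "\<bar>x\<bar> \<le> pi" using that by auto
        have "norm (T x) = norm (f x - f 0) * (\<bar>sin (real n * x)\<bar> * fejer_kernel n x)"
          using fejer_kernel_nonneg[OF x, of n] by (simp add: T_def norm_mult abs_mult)
        also have "\<dots> \<le> (e + C * (1 - cos x)) * (1 * fejer_kernel n x)"
          using C x e fejer_kernel_nonneg[OF x, of n] by (intro mult_mono) auto
        also have "\<dots> = e * fejer_kernel n x + C * (fejer_kernel n x * (1 - cos x))"
          by (simp add: algebra_simps)
        also have "\<dots> \<le> e * fejer_kernel n x + C * 2"
          unfolding fejer_kernel_mult_one_minus_cos
          using C(1) cos_ge_minus_one[of "real (Suc n) * x"] by (intro add_left_mono mult_left_mono) auto
        finally show ?thesis by simp
      qed
      then have "norm (integral {-pi..pi} T) \<le> integral {-pi..pi} (\<lambda>x. e * fejer_kernel n x + 2 * C)"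
        using T g by (intro integral_norm_bound_integral) (auto simp: has_integral_iff)
      then have "\<bar>pi * B\<bar> \<le> e * (2 * pi * real (Suc n)) + 2 * pi * (2 * C)"
        unfolding integral_unique[OF T] integral_unique[OF g] norm_of_real .
      also have "\<dots> = pi * (2 * e * real (Suc n) + 4 * C)"
        by (simp add: algebra_simps)
      finally have "pi * B \<le> pi * (2 * e * real (Suc n) + 4 * C)"
        by linarith
      then have "B \<le> 2 * e * real (Suc n) + 4 * C" by (subst (asm) mult_le_cancel_left_pos) auto
      moreover have "A n \<le> B" unfolding A_def B_def by (rule sum_le_symmetric_sums[OF nonneg])
      ultimately show ?thesis by linarith
    qed
    then show ?thesis by blast
  qed
  have "(\<lambda>n. A n / real n) \<longlonglongrightarrow> 0"
  proof (rule LIMSEQ_I)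
    fix e :: real assume e: "e > 0"
    \<comment> \<open>With \<open>e / 8\<close> the bound is
      \<open>e / 4 + e * n / 4 + 4 * C\<close>. For \<open>n \<ge> 1\<close> the first two terms are
      at most \<open>e * n / 2\<close>, and \<open>n > 8 * \<bar>C\<bar> / e\<close> makes the last
      one smaller than \<open>e * n / 2\<close>.\<close>
    then obtain C where C: "\<And>n. A n \<le> 2 * (e / 8) * real (Suc n) + 4 * C"
      using bound[of "e / 8"] by auto
    obtain N :: nat where N: "real N > 8 * \<bar>C\<bar> / e" using reals_Archimedean2 by blast
    show "\<exists>no. \<forall>n\<ge>no. norm (A n / real n - 0) < e"
    proof (intro exI allI impI)
      fix n assume n: "n \<ge> Suc N"
      then have "real n > 8 * \<bar>C\<bar> / e" using N by linarith
      then have "8 * \<bar>C\<bar> < e * real n" using e by (simp add: field_simps)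
      moreover have "e * 1 \<le> e * real n" using e n by (intro mult_left_mono) auto
      moreover have "2 * (e / 8) * real (Suc n) = e / 4 + e * real n / 4" by (simp add: field_simps)
      then have "A n \<le> e / 4 + e * real n / 4 + 4 * C" using C[of n] by (simp only:)
      ultimately have "A n < e * real n" using e by linarith
      then show "norm (A n / real n - 0) < e" using n A0[of n] by (simp add: field_simps)
    qed
  qed
  then show ?thesis by (simp add: A_def)
qed

theorem theorem4:
  fixes r :: nat and b :: "nat \<Rightarrow> real"
  assumes "r \<ge> 1"
    and "\<And>n. n \<ge> 1 \<Longrightarrow> b n \<ge> 0"
    and "(\<lambda>n. complex_of_real (b n)) \<in> GM_beta_star r"
    and "uniformly_convergent_on UNIV (\<lambda>N x::real. \<Sum>n = 1..N. b n * sin (real n * x)) \<or>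
         (\<exists>f :: real \<Rightarrow> complex. continuous_on UNIV f \<and> (\<forall>x. f (x + 2 * pi) = f x) \<and>
            sine_series_is_fourier_series_of b f)"
  shows "(\<lambda>n. real n * b n) \<longlonglongrightarrow> 0"
proof (rule GM_beta_star_tendsto_zero[OF assms(1-3)])
  \<comment> \<open>Both alternatives enter only through these means.\<close>
  show "(\<lambda>n. (\<Sum>j = 1..n. real j * b j) / real n) \<longlonglongrightarrow> 0"
    using assms(4)
  proof (elim disjE exE conjE)
    assume "uniformly_convergent_on UNIV (\<lambda>N x::real. \<Sum>n = 1..N. b n * sin (real n * x))"
    then show ?thesis by (rule means_tendsto_zero_if_uniformly_convergent[rotated]) (rule assms(2))
  next
    fix f :: "real \<Rightarrow> complex"
    assume "continuous_on UNIV f" "sine_series_is_fourier_series_of b f"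
    then show ?thesis by (rule means_tendsto_zero_if_continuous[rotated]) (rule assms(2))
  qed
qed

end
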